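(* Let $\gamma : I\to\mathbb{R}^3$ be a smooth curve on an open interval $I$ parametrized by arc length $s$, with nowhere vanishing curvature and unit tangent $T$. Let $c$ be a real constant with $c-s>0$ for all $s\in I$, and let $\widetilde\gamma=\gamma+(c-s)T$ be the involute of $\gamma$ (so that $\gamma$ is the evolute of $\widetilde\gamma$). Then the tangent indicatrix of $\widetilde\gamma$ is a circle on the unit sphere if and only if the evolute $\gamma$ of $\widetilde\gamma$ is a slant helix.
   Context: The tangent indicatrix of $\widetilde\gamma$ is the curve traced on the unit sphere by its unit tangent vector $\widetilde T$. "Is a circle on the unit sphere" means that the indicatrix lies on (is an arc of) the intersection of the unit sphere with a plane. For a curve with arc-length parameter $u$, curvature $k>0$, torsion $t$ and $g=t/k$, the curve is a slant helix if its principal normal lines make a constant angle with a fixed direction; equivalently (known characterization of Izumiya and Takeuchi), the function $\frac{dg/du}{k(1+g^2)^{3/2}}$ is constant. *)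

theory Defs
  imports "HOL-Analysis.Analysis"
begin

text \<open>
  A parametrized curve is a function on the reals of which only the values on an open
  parameter set are relevant; two-sided derivatives are therefore used throughout.
\<close>

definition smooth_curve_on :: "(real \<Rightarrow> 'a::real_normed_vector) \<Rightarrow> real set \<Rightarrow> bool" where
  "smooth_curve_on \<gamma> I \<longleftrightarrow>
     (\<forall>n. \<forall>s\<in>I. ((\<lambda>f x. vector_derivative f (at x)) ^^ n) \<gamma> differentiable (at s))"

definition arc_length_parametrized_on :: "(real \<Rightarrow> real^3) \<Rightarrow> real set \<Rightarrow> bool" where
  "arc_length_parametrized_on \<gamma> I \<longleftrightarrow> (\<forall>s\<in>I. norm (vector_derivative \<gamma> (at s)) = 1)"

definition unit_tangent :: "(real \<Rightarrow> real^3) \<Rightarrow> real \<Rightarrow> real^3" where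
  "unit_tangent \<gamma> s = sgn (vector_derivative \<gamma> (at s))"

text \<open>
  Curvature and principal normal are defined for an arbitrary regular parameter;
  the division by the speed is trivial for an arc-length parameter.
\<close>

definition curvature :: "(real \<Rightarrow> real^3) \<Rightarrow> real \<Rightarrow> real" where
  "curvature \<gamma> s =
     norm (vector_derivative (unit_tangent \<gamma>) (at s)) / norm (vector_derivative \<gamma> (at s))"

definition principal_normal :: "(real \<Rightarrow> real^3) \<Rightarrow> real \<Rightarrow> real^3" where
  "principal_normal \<gamma> s = sgn (vector_derivative (unit_tangent \<gamma>) (at s))"

definition involute :: "(real \<Rightarrow> real^3) \<Rightarrow> real \<Rightarrow> real \<Rightarrow> real^3" where
  "involute \<gamma> c s = \<gamma> s + (c - s) *\<^sub>R unit_tangent \<gamma> s"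

definition tangent_indicatrix :: "(real \<Rightarrow> real^3) \<Rightarrow> real set \<Rightarrow> (real^3) set" where
  "tangent_indicatrix \<gamma> I = unit_tangent \<gamma> ` I"

text \<open>
  Only containment is required, as a curve over an interval in general
  traces an arc of a circle.  The plane need not pass through the origin.
\<close>

definition is_circle_on_unit_sphere :: "(real^3) set \<Rightarrow> bool" where
  "is_circle_on_unit_sphere C \<longleftrightarrow>
     (\<exists>a b. a \<noteq> 0 \<and> C \<subseteq> sphere 0 1 \<inter> {x. a \<bullet> x = b})"

text \<open>
  The angle, between 0 and a right angle, enclosed by the undirected lines
  spanned by two nonzero vectors; hence the absolute value.
\<close>

definition line_angle :: "real^3 \<Rightarrow> real^3 \<Rightarrow> real" where
  "line_angle v w = arccos (\<bar>v \<bullet> w\<bar> / (norm v * norm w))"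

definition slant_helix_on :: "(real \<Rightarrow> real^3) \<Rightarrow> real set \<Rightarrow> bool" where
  "slant_helix_on \<gamma> I \<longleftrightarrow>
     (\<exists>d \<theta>. d \<noteq> 0 \<and> (\<forall>s\<in>I. line_angle (principal_normal \<gamma> s) d = \<theta>))"

end

theory Submission
  imports Defs
begin

text \<open>
  The involute is regular with velocity \<open>T + (c - s) T' - T = (c - s) T'\<close>, and \<open>c - s > 0\<close>;
  hence its unit tangent is the principal normal \<open>N\<close> of the original curve
  (\<open>unit_tangent_involute\<close>). The claim thus compares two conditions on \<open>N\<close>: that its values
  lie in a plane \<open>d \<bullet> x = b\<close>, and that the lines spanned by them enclose a constant angle
  with some direction \<open>d\<close>. Since \<open>N\<close> is a unit vector, the first says that \<open>N \<bullet> d\<close> is constant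
  and the second that \<open>\<bar>N \<bullet> d\<bar>\<close> is (\<open>line_angle_eq_iff\<close>). Constancy of the absolute
  value passes to \<open>N \<bullet> d\<close> itself because \<open>N\<close> is continuous on an interval, so that
  \<open>N \<bullet> d\<close> cannot jump between the two values \<open>k\<close> and \<open>- k\<close>
  (\<open>constant_on_if_abs_constant\<close>).
\<close>

text \<open>
  Everything about the Frenet apparatus of a unit speed curve rests on this: the unit tangent
  is the velocity not only at a point but on an open set, and so the two have the same
  derivative.
\<close>

lemma unit_tangent_has_vector_derivative:
  assumes "open I" "smooth_curve_on \<gamma> I" "arc_length_parametrized_on \<gamma> I" "s \<in> I"
  shows "(unit_tangent \<gamma> has_vector_derivative
           vector_derivative (\<lambda>x. vector_derivative \<gamma> (at x)) (at s)) (at s)"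
proof (rule has_vector_derivative_transform_within_open[OF _ assms(1,4)])
  have "(\<lambda>x. vector_derivative \<gamma> (at x)) differentiable (at s)"
    using assms(2,4) unfolding smooth_curve_on_def
    by (metis (no_types, lifting) funpow_0 comp_apply funpow.simps(2) One_nat_def)
  then show "((\<lambda>x. vector_derivative \<gamma> (at x)) has_vector_derivative
      vector_derivative (\<lambda>x. vector_derivative \<gamma> (at x)) (at s)) (at s)"
    by (simp add: vector_derivative_works)
  show "vector_derivative \<gamma> (at x) = unit_tangent \<gamma> x" if "x \<in> I" for x
    using assms(3) that
    by (simp add: unit_tangent_def arc_length_parametrized_on_def sgn_div_norm)
qed

lemma norm_principal_normal:
  assumes "curvature \<gamma> s \<noteq> 0"
  shows "norm (principal_normal \<gamma> s) = 1"
  using assms by (auto simp: curvature_def principal_normal_def norm_sgn)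

lemma continuous_on_principal_normal:
  assumes "open I" "smooth_curve_on \<gamma> I" "arc_length_parametrized_on \<gamma> I"
    and "\<forall>s\<in>I. curvature \<gamma> s \<noteq> 0"
  shows "continuous_on I (principal_normal \<gamma>)"
proof -
  define A where "A = (\<lambda>x. vector_derivative (\<lambda>x. vector_derivative \<gamma> (at x)) (at x))"
  have A: "vector_derivative (unit_tangent \<gamma>) (at s) = A s" if "s \<in> I" for s
    using unit_tangent_has_vector_derivative[OF assms(1-3) that]
    by (simp add: A_def vector_derivative_at)
  have "A differentiable (at s)" if "s \<in> I" for s
    using assms(2)[unfolded smooth_curve_on_def, rule_format, OF that, of 2]
    by (simp add: A_def numeral_2_eq_2)
  then have cont: "continuous_on I A"
    by (simp add: continuous_at_imp_continuous_on differentiable_imp_continuous_within)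
  have "A s \<noteq> 0" if "s \<in> I" for s
    using assms(4) A that by (auto simp: curvature_def)
  with cont have "continuous_on I (\<lambda>s. sgn (A s))"
    unfolding sgn_div_norm by (intro continuous_intros) auto
  then show ?thesis
    by (rule continuous_on_eq) (simp add: principal_normal_def A)
qed

text \<open>
  Differentiating the factor \<open>c - s\<close> cancels the velocity \<open>T\<close> of the curve, so that
  only a positive multiple of \<open>T'\<close> is left.
\<close>

lemma unit_tangent_involute:
  assumes "open I" "smooth_curve_on \<gamma> I" "arc_length_parametrized_on \<gamma> I" "s \<in> I"
    and "c - s > 0"
  shows "unit_tangent (involute \<gamma> c) s = principal_normal \<gamma> s"
proof -
  define T' where "T' = vector_derivative (unit_tangent \<gamma>) (at s)"
  have T: "(unit_tangent \<gamma> has_vector_derivative T') (at s)"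
    using unit_tangent_has_vector_derivative[OF assms(1-4)]
    by (simp add: T'_def vector_derivative_at)
  have "\<gamma> differentiable (at s)"
    using assms(2)[unfolded smooth_curve_on_def, rule_format, OF assms(4), of 0] by simp
  moreover have "vector_derivative \<gamma> (at s) = unit_tangent \<gamma> s"
    using assms(3,4)
    by (simp add: unit_tangent_def arc_length_parametrized_on_def sgn_div_norm)
  ultimately have "(\<gamma> has_vector_derivative unit_tangent \<gamma> s) (at s)"
    by (simp add: vector_derivative_works)
  then have "((\<lambda>x. \<gamma> x + (c - x) *\<^sub>R unit_tangent \<gamma> x) has_vector_derivative
      unit_tangent \<gamma> s + ((c - s) *\<^sub>R T' + (- 1) *\<^sub>R unit_tangent \<gamma> s)) (at s)"
    using T by (intro derivative_intros has_vector_derivative_scaleR)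
      (auto intro!: derivative_eq_intros)
  then have "vector_derivative (involute \<gamma> c) (at s) = (c - s) *\<^sub>R T'"
    unfolding involute_def[abs_def] by (simp add: vector_derivative_at)
  then show ?thesis
    using assms(5) by (simp add: unit_tangent_def principal_normal_def T'_def sgn_scaleR)
qed

text \<open>
  The cosine of a line angle lies in \<open>[0, 1]\<close> by the Cauchy-Schwarz inequality, and
  \<open>arccos\<close> is injective there.
\<close>

lemma line_angle_eq_iff:
  assumes "norm v = 1" "norm w = 1" "d \<noteq> 0"
  shows "line_angle v d = line_angle w d \<longleftrightarrow> \<bar>v \<bullet> d\<bar> = \<bar>w \<bullet> d\<bar>"
proof -
  have "\<bar>u \<bullet> d\<bar> / norm d \<in> {0..1}" if "norm u = 1" for u
    using Cauchy_Schwarz_ineq2[of u d] that assms(3) by simp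
  then show ?thesis
    using assms by (auto simp: line_angle_def arccos_eq_iff)
qed

text \<open>
  Such a function has at most the two values \<open>k\<close> and \<open>- k\<close>, and a continuous function
  with finite range is constant on a connected set.
\<close>

lemma constant_on_if_abs_constant:
  fixes f :: "'a::topological_space \<Rightarrow> real"
  assumes "connected S" "continuous_on S f" "\<And>x. x \<in> S \<Longrightarrow> \<bar>f x\<bar> = k"
  shows "f constant_on S"
proof (rule continuous_finite_range_constant[OF assms(1,2)])
  have "f ` S \<subseteq> {k, - k}"
    using assms(3) by force
  then show "finite (f ` S)"
    by (rule finite_subset) simp
qed

theorem corollary1:
  fixes \<gamma> :: "real \<Rightarrow> real^3" and I :: "real set" and c :: real
  assumes "open I" and "is_interval I" and "I \<noteq> {}"
    and "smooth_curve_on \<gamma> I"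
    and "arc_length_parametrized_on \<gamma> I"
    and "\<forall>s\<in>I. curvature \<gamma> s \<noteq> 0"
    and "\<forall>s\<in>I. c - s > 0"
  shows "is_circle_on_unit_sphere (tangent_indicatrix (involute \<gamma> c) I)
           \<longleftrightarrow> slant_helix_on \<gamma> I"
proof -
  let ?N = "principal_normal \<gamma>"
  have unit: "norm (?N s) = 1" if "s \<in> I" for s
    using assms(6) that by (simp add: norm_principal_normal)
  have "tangent_indicatrix (involute \<gamma> c) I = ?N ` I"
    using unit_tangent_involute[OF assms(1,4,5)] assms(7)
    by (simp add: tangent_indicatrix_def)
  then have circle: "is_circle_on_unit_sphere (tangent_indicatrix (involute \<gamma> c) I)
      \<longleftrightarrow> (\<exists>d b. d \<noteq> 0 \<and> (\<forall>s\<in>I. d \<bullet> ?N s = b))"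
    using unit by (simp add: is_circle_on_unit_sphere_def image_subset_iff)
  show ?thesis
  proof
    assume "is_circle_on_unit_sphere (tangent_indicatrix (involute \<gamma> c) I)"
    then obtain d b where d: "d \<noteq> 0" and b: "\<forall>s\<in>I. d \<bullet> ?N s = b"
      using circle by blast
    have "\<forall>s\<in>I. line_angle (?N s) d = arccos (\<bar>b\<bar> / norm d)"
      using b unit by (simp add: line_angle_def inner_commute)
    with d show "slant_helix_on \<gamma> I"
      unfolding slant_helix_on_def by blast
  next
    assume "slant_helix_on \<gamma> I"
    then obtain d \<theta> where d: "d \<noteq> 0" and \<theta>: "\<forall>s\<in>I. line_angle (?N s) d = \<theta>"
      unfolding slant_helix_on_def by blast
    obtain s\<^sub>0 where s\<^sub>0: "s\<^sub>0 \<in> I"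
      using assms(3) by blast
    have "\<bar>d \<bullet> ?N s\<bar> = \<bar>d \<bullet> ?N s\<^sub>0\<bar>" if "s \<in> I" for s
      using line_angle_eq_iff[OF unit[OF that] unit[OF s\<^sub>0] d] \<theta> that s\<^sub>0
      by (simp add: inner_commute)
    moreover have "continuous_on I (\<lambda>s. d \<bullet> ?N s)"
      using continuous_on_principal_normal[OF assms(1,4,5,6)] by (intro continuous_intros)
    moreover have "connected I"
      using assms(2) by (rule is_interval_connected)
    ultimately have "(\<lambda>s. d \<bullet> ?N s) constant_on I"
      by (intro constant_on_if_abs_constant)
    with d show "is_circle_on_unit_sphere (tangent_indicatrix (involute \<gamma> c) I)"
      unfolding circle constant_on_def by blast
  qed
qed

end
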